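(* For every integer $n \ge 1$, the path $P_n$ on $n$ vertices satisfies \[\left\lceil \sqrt{2n+1}-1 \right\rceil \le b_{\rm g}(P_n) \le \left\lceil \sqrt{2n+\tfrac{1}{4}}-\tfrac{1}{2} \right\rceil\] and \[\left\lceil \sqrt{2n+2}-1 \right\rceil \le b_{\rm g}'(P_n) \le \left\lceil \sqrt{2n+\tfrac{1}{4}}-\tfrac{1}{2} \right\rceil.\]
   Context: The burning game on a finite simple graph $G$ is played by two players, Burner and Staller. Each vertex is either burned or unburned, and once burned it stays burned. In round 1 the starting player chooses one unburned vertex and burns it (selection phase only). Each round $t \ge 2$ consists of a spreading phase, in which every unburned vertex with a burned neighbor becomes burned, followed, if unburned vertices remain, by a selection phase in which the player whose turn it is burns one unburned vertex; the two players make the selections alternately. The game ends in the first round in which all vertices are burned (this may happen right after a spreading phase), and its length is the number of that round. Burner wants to minimize the length and Staller to maximize it. $b_{\rm g}(G)$ is the length under optimal play when Burner makes the first selection, and $b_{\rm g}'(G)$ is the length under optimal play when Staller makes the first selection. *)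

theory Defs
  imports Complex_Main "Graph_Theory.Pair_Digraph"
begin

text \<open>Finite simple graphs are the instances of the locale \<open>pair_graph\<close>: finite,
  loop-free and with a symmetric arc set.\<close>

definition path_graph :: "nat \<Rightarrow> nat pair_pre_digraph" where
  "path_graph n =
     \<lparr> pverts = {..<n}, parcs = {(i, j). i < n \<and> j < n \<and> (j = Suc i \<or> i = Suc j)} \<rparr>"

lemma pair_graph_path_graph: "pair_graph (path_graph n)"
proof
  show "finite (parcs (path_graph n))"
    by (rule finite_subset[of _ "{..<n} \<times> {..<n}"]) (auto simp: path_graph_def)
qed (auto simp: path_graph_def sym_def symmetric_def arcs_ends_def arc_to_ends_def)

definition spread :: "'a pair_pre_digraph \<Rightarrow> 'a set \<Rightarrow> 'a set" where
  "spread G B = B \<union> {v \<in> pverts G. \<exists>u\<in>B. (u, v) \<in> parcs G}"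

datatype player = Burner | Staller

fun opponent :: "player \<Rightarrow> player" where
  "opponent Burner = Staller"
| "opponent Staller = Burner"

fun optimum :: "player \<Rightarrow> nat set \<Rightarrow> nat" where
  "optimum Burner = Min"
| "optimum Staller = Max"

text \<open>\<open>rounds_left G p B\<close> is the number of rounds still to be played, under optimal play,
  when \<open>B\<close> is the set of burned vertices at the end of a round and \<open>p\<close> makes the next
  selection. A round that starts from \<open>B\<close> first burns \<open>spread G B\<close>; it is the last one
  if this covers the graph or if the selected vertex was the only one missing.
  Since \<open>spread G {} = {}\<close>, round 1 consists of a selection only.
  The finiteness test is there for termination; infinite graphs get the dummy value 0.\<close>

function rounds_left :: "'a pair_pre_digraph \<Rightarrow> player \<Rightarrow> 'a set \<Rightarrow> nat" where
  "rounds_left G p B =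
     (if infinite (pverts G) \<or> pverts G \<subseteq> B then 0
      else if pverts G \<subseteq> spread G B then 1
      else 1 + optimum p ((\<lambda>v. rounds_left G (opponent p) (insert v (spread G B)))
                            ` (pverts G - spread G B)))"
  by pat_completeness auto
termination
proof (relation "measure (\<lambda>(G, p, B). card (pverts G - B))", goal_cases)
  case (2 G p B v)
  then have "pverts G - insert v (spread G B) \<subset> pverts G - B"
    by (auto simp: spread_def)
  moreover have "finite (pverts G - B)"
    using 2 by simp
  ultimately show ?case
    by (simp only: in_measure prod.case psubset_card_mono)
qed simp

declare rounds_left.simps [simp del]

definition b_g :: "'a pair_pre_digraph \<Rightarrow> nat" where
  "b_g G = rounds_left G Burner {}"

definition b_g' :: "'a pair_pre_digraph \<Rightarrow> nat" where
  "b_g' G = rounds_left G Staller {}"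

end

theory Submission
  imports Defs
begin

text \<open>
  Upper bounds: with \<open>r\<close> rounds to go, let \<open>U\<close> contain all vertices at distance more than \<open>r\<close>
  from the burned ones. Burner keeps \<open>2 |U| + 2 r m \<le> r (r + 3)\<close> before each of his turns,
  where \<open>m\<close> is the number of maximal intervals (runs) of \<open>U\<close>: he cuts an initial segment of length
  \<open>2 r - 1\<close> off a run of at least this length if there is one, and otherwise removes a longest run.
  A selection of Staller increases \<open>m\<close> only by splitting a run, which removes many vertices from \<open>U\<close>.

  Lower bounds: Staller always burns a vertex next to a burned one, so that the number of adjacent
  pairs of a burned and an unburned vertex, which bounds the effect of a spreading phase,
  only grows by Burner's selections, by at most 2 each.
\<close>

section \<open>The game recursion\<close>

lemma rounds_left_le_0_iff:
  assumes "finite (pverts G)"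
  shows "rounds_left G p B \<le> 0 \<longleftrightarrow> pverts G \<subseteq> B"
  using assms by (subst rounds_left.simps) auto

lemma rounds_left_Burner_le_Suc_iff:
  assumes "finite (pverts G)"
  shows "rounds_left G Burner B \<le> Suc r \<longleftrightarrow> pverts G \<subseteq> spread G B \<or>
    (\<exists>v \<in> pverts G - spread G B. rounds_left G Staller (insert v (spread G B)) \<le> r)"
proof -
  have "B \<subseteq> spread G B"
    by (auto simp: spread_def)
  then show ?thesis
    using assms by (subst rounds_left.simps) (auto simp: Min_le_iff)
qed

text \<open>If spreading already covers the graph, the universal statement is vacuous; the
  existential one for Burner needs its own disjunct for that case.\<close>

lemma rounds_left_Staller_le_Suc_iff:
  assumes "finite (pverts G)"
  shows "rounds_left G Staller B \<le> Suc r \<longleftrightarrow>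
    (\<forall>v \<in> pverts G - spread G B. rounds_left G Burner (insert v (spread G B)) \<le> r)"
proof -
  have "B \<subseteq> spread G B"
    by (auto simp: spread_def)
  then show ?thesis
    using assms by (subst rounds_left.simps) (auto simp: Max_le_iff)
qed

lemma pverts_path_graph [simp]: "pverts (path_graph n) = {..<n}"
  by (simp add: path_graph_def)

lemma spread_path_graph:
  "spread (path_graph n) B =
     B \<union> {v. v < n \<and> (\<exists>u\<in>B. u < n \<and> (v = Suc u \<or> u = Suc v))}"
  by (auto simp: spread_def path_graph_def)

lemma spread_path_graph_subset:
  "B \<subseteq> {..<n} \<Longrightarrow> spread (path_graph n) B \<subseteq> {..<n}"
  by (auto simp: spread_path_graph)

section \<open>Staller's strategy\<close>

definition right_ends :: "nat \<Rightarrow> nat set \<Rightarrow> nat set" where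
  "right_ends n B = {i. Suc i < n \<and> i \<in> B \<and> Suc i \<notin> B}"

text \<open>In both sets a pair of neighbours is indexed by its smaller vertex: the burned one in
  \<open>right_ends\<close>, the unburned one in \<open>left_ends\<close>.\<close>

definition left_ends :: "nat \<Rightarrow> nat set \<Rightarrow> nat set" where
  "left_ends n B = {i. Suc i < n \<and> i \<notin> B \<and> Suc i \<in> B}"

definition frontier_size :: "nat \<Rightarrow> nat set \<Rightarrow> nat" where
  "frontier_size n B = card (right_ends n B) + card (left_ends n B)"

lemma finite_right_ends [simp]: "finite (right_ends n B)"
  by (rule finite_subset[of _ "{..<n}"]) (auto simp: right_ends_def)

lemma finite_left_ends [simp]: "finite (left_ends n B)"
  by (rule finite_subset[of _ "{..<n}"]) (auto simp: left_ends_def)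

text \<open>Spreading moves every surviving boundary one step outwards: a right end at
  \<open>i\<close> stems from one at \<open>i - 1\<close>, a left end at \<open>i\<close> from one
  at \<open>i + 1\<close>.\<close>

lemma frontier_size_spread:
  assumes "B \<subseteq> {..<n}"
  shows "frontier_size n (spread (path_graph n) B) \<le> frontier_size n B"
proof -
  let ?X = "spread (path_graph n) B"
  have "right_ends n ?X \<subseteq> Suc ` right_ends n B"
  proof
    fix i assume i: "i \<in> right_ends n ?X"
    then have "i \<notin> B" "Suc i \<notin> B" "i \<in> ?X" "Suc i < n"
      by (auto simp: right_ends_def spread_path_graph)
    then show "i \<in> Suc ` right_ends n B"
      by (auto simp: right_ends_def spread_path_graph)
  qed
  then have "card (right_ends n ?X) \<le> card (Suc ` right_ends n B)"
    by (intro card_mono) auto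
  moreover have "Suc ` left_ends n ?X \<subseteq> left_ends n B"
  proof
    fix j assume "j \<in> Suc ` left_ends n ?X"
    then obtain i where i: "j = Suc i" "i \<in> left_ends n ?X"
      by auto
    then have "i \<notin> B" "Suc i \<notin> B" "Suc i \<in> ?X" "Suc i < n"
      by (auto simp: left_ends_def spread_path_graph)
    then show "j \<in> left_ends n B"
      using i(1) by (auto simp: left_ends_def spread_path_graph)
  qed
  then have "card (Suc ` left_ends n ?X) \<le> card (left_ends n B)"
    by (intro card_mono) auto
  ultimately show ?thesis
    by (simp add: frontier_size_def card_image)
qed

text \<open>Each vertex burned by spreading is the unburned member of a frontier pair; for a right
  end \<open>i\<close> this is \<open>Suc i\<close>.\<close>

lemma card_unburned_le:
  assumes "B \<subseteq> {..<n}"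
  shows "card ({..<n} - B) \<le> frontier_size n B + card ({..<n} - spread (path_graph n) B)"
proof -
  let ?X = "spread (path_graph n) B"
  have "{..<n} - B \<subseteq> (Suc ` right_ends n B \<union> left_ends n B) \<union> ({..<n} - ?X)"
    by (auto simp: right_ends_def left_ends_def spread_path_graph)
  then have "card ({..<n} - B) \<le> card ((Suc ` right_ends n B \<union> left_ends n B) \<union> ({..<n} - ?X))"
    by (intro card_mono) auto
  also have "\<dots> \<le> card (Suc ` right_ends n B) + card (left_ends n B) + card ({..<n} - ?X)"
    by (meson card_Un_le add_mono le_trans order_refl)
  finally show ?thesis
    by (simp add: frontier_size_def card_image)
qed

lemma frontier_size_insert: "frontier_size n (insert v X) \<le> frontier_size n X + 2"
proof -
  have "right_ends n (insert v X) \<subseteq> insert v (right_ends n X)"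
    by (auto simp: right_ends_def)
  then have "card (right_ends n (insert v X)) \<le> card (insert v (right_ends n X))"
    by (intro card_mono) auto
  moreover have "left_ends n (insert v X) \<subseteq> insert (v - 1) (left_ends n X)"
    by (auto simp: left_ends_def)
  then have "card (left_ends n (insert v X)) \<le> card (insert (v - 1) (left_ends n X))"
    by (intro card_mono) auto
  ultimately show ?thesis
    using card_insert_le_m1[of "Suc (card (right_ends n X))" "right_ends n X" v]
      card_insert_le_m1[of "Suc (card (left_ends n X))" "left_ends n X" "v - 1"]
    by (simp add: frontier_size_def)
qed

lemma card_le_swap:
  assumes "finite A" "i \<in> A" "C \<subseteq> insert v (A - {i})"
  shows "card C \<le> card A"
proof -
  have "card C \<le> card (insert v (A - {i}))"
    using assms by (intro card_mono) auto
  also have "\<dots> \<le> Suc (card (A - {i}))"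
    using assms by (simp add: card_insert_if)
  also have "\<dots> = card A"
    using assms by (metis card_Suc_Diff1)
  finally show ?thesis .
qed

lemma frontier_nonempty:
  assumes "X \<subseteq> {..<n}" "X \<noteq> {}" "\<not> {..<n} \<subseteq> X"
  obtains i where "Suc i < n" "(i \<in> X) \<noteq> (Suc i \<in> X)"
proof -
  have "\<exists>i. Suc i < n \<and> (i \<in> X) \<noteq> (Suc i \<in> X)"
  proof (rule ccontr)
    assume contr: "\<not> ?thesis"
    have "i < n \<Longrightarrow> i \<in> X \<longleftrightarrow> 0 \<in> X" for i
    proof (induction i)
      case (Suc i)
      with contr show ?case by auto
    qed simp
    with assms show False by blast
  qed
  with that show thesis by blast
qed

text \<open>This is Staller's selection: enlarging a burned block by one neighbouring vertex shifts
  its end by one or removes it, and creates no other end.\<close>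

lemma frontier_size_insert_adjacent:
  assumes "X \<subseteq> {..<n}" "X \<noteq> {}" "\<not> {..<n} \<subseteq> X"
  obtains v where "v < n" "v \<notin> X" "frontier_size n (insert v X) \<le> frontier_size n X"
proof -
  obtain i where i: "Suc i < n" "(i \<in> X) \<noteq> (Suc i \<in> X)"
    using frontier_nonempty[OF assms] .
  show thesis
  proof (cases "i \<in> X")
    case True
    have "card (right_ends n (insert (Suc i) X)) \<le> card (right_ends n X)"
      by (rule card_le_swap[OF finite_right_ends, where i = i and v = "Suc i"]) (use True i in \<open>auto simp: right_ends_def\<close>)
    moreover have "card (left_ends n (insert (Suc i) X)) \<le> card (left_ends n X)"
      by (rule card_mono[OF finite_left_ends]) (use True i in \<open>auto simp: left_ends_def\<close>)
    ultimately show thesis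
      using that[of "Suc i"] True i by (simp add: frontier_size_def)
  next
    case False
    have "card (left_ends n (insert i X)) \<le> card (left_ends n X)"
      by (rule card_le_swap[OF finite_left_ends, where i = i and v = "i - 1"]) (use False i in \<open>auto simp: left_ends_def\<close>)
    moreover have "card (right_ends n (insert i X)) \<le> card (right_ends n X)"
      by (rule card_mono[OF finite_right_ends]) (use False i in \<open>auto simp: right_ends_def\<close>)
    ultimately show thesis
      using that[of i] False i by (simp add: frontier_size_def)
  qed
qed

lemma card_unburned_insert:
  fixes v n :: nat
  assumes "v < n" "v \<notin> X"
  shows "card ({..<n} - X) = Suc (card ({..<n} - insert v X))"
proof -
  have "{..<n} - insert v X = ({..<n} - X) - {v}" by auto
  moreover have "finite ({..<n} - X)" "v \<in> {..<n} - X"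
    using assms by simp_all
  ultimately show ?thesis
    using card_Suc_Diff1[of "{..<n} - X" v] by metis
qed

text \<open>From an initial frontier \<open>f\<close>, each spreading phase burns at most
  \<open>f\<close> vertices plus 2 for every earlier selection of Burner, and each selection burns
  1. Summing over \<open>r\<close> rounds, doubling and rounding up for parity gives the two bounds,
  according to who selects first. Staller needs \<open>B\<close> nonempty to have a burned vertex to
  play next to.\<close>

lemma rounds_left_lower:
  assumes "B \<subseteq> {..<n}"
  shows "(rounds_left (path_graph n) Burner B \<le> r \<longrightarrow>
           2 * card ({..<n} - B) \<le> 2 * r * frontier_size n B + r\<^sup>2 + 2 * r) \<and>
         (B \<noteq> {} \<longrightarrow> rounds_left (path_graph n) Staller B \<le> r \<longrightarrow>
           2 * card ({..<n} - B) \<le> 2 * r * frontier_size n B + r\<^sup>2 + 1)"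
  using assms
proof (induction r arbitrary: B)
  case 0
  have "card ({..<n} - B) = 0" if "rounds_left (path_graph n) p B \<le> 0" for p
  proof -
    have "{..<n} - B = {}"
      using that by (simp only: rounds_left_le_0_iff finite_lessThan pverts_path_graph) auto
    then show ?thesis by (simp only: card.empty)
  qed
  then show ?case by (metis le0 mult_0_right)
next
  case (Suc r)
  define X where "X = spread (path_graph n) B"
  have X: "X \<subseteq> {..<n}" "B \<subseteq> X"
    using spread_path_graph_subset[OF Suc.prems] by (auto simp: X_def spread_def)
  have unburned: "card ({..<n} - B) \<le> frontier_size n B + card ({..<n} - X)"
    unfolding X_def by (rule card_unburned_le[OF Suc.prems])
  have frontier: "frontier_size n X \<le> frontier_size n B"
    unfolding X_def by (rule frontier_size_spread[OF Suc.prems])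
  \<comment> \<open>If spreading ends the game, the frontier alone accounts for all unburned
    vertices, so any \<open>c\<close> will do.\<close>
  have covered: "2 * card ({..<n} - B) \<le> 2 * Suc r * frontier_size n B + c"
    if "{..<n} \<subseteq> X" for c
  proof -
    have "{..<n} - X = {}" using that by auto
    then show ?thesis using unburned by (simp only: card.empty) simp
  qed
  have Burner: "2 * card ({..<n} - B) \<le> 2 * Suc r * frontier_size n B + ((Suc r)\<^sup>2 + 2 * Suc r)"
    if left: "rounds_left (path_graph n) Burner B \<le> Suc r"
  proof (cases "{..<n} \<subseteq> X")
    case False
    then obtain v where v: "v < n" "v \<notin> X"
      and "rounds_left (path_graph n) Staller (insert v X) \<le> r"
      using left by (auto simp: rounds_left_Burner_le_Suc_iff X_def)
    then have "2 * card ({..<n} - insert v X) \<le> 2 * r * frontier_size n (insert v X) + r\<^sup>2 + 1"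
      using Suc.IH[of "insert v X"] X by auto
    also have "\<dots> \<le> 2 * r * (frontier_size n B + 2) + r\<^sup>2 + 1"
      using frontier_size_insert[of n v X] frontier by (intro add_mono mult_left_mono) auto
    \<comment> \<open>The induction closes without slack:
      \<open>r^2 + 1 + 4 * r + 2 = (Suc r)^2 + 2 * Suc r\<close>.\<close>
    finally show ?thesis
      using unburned card_unburned_insert[OF v] by (simp add: power2_eq_square algebra_simps)
  qed (rule covered)
  have Staller: "2 * card ({..<n} - B) \<le> 2 * Suc r * frontier_size n B + ((Suc r)\<^sup>2 + 1)"
    if "B \<noteq> {}" "rounds_left (path_graph n) Staller B \<le> Suc r"
  proof (cases "{..<n} \<subseteq> X")
    case False
    then obtain v where v: "v < n" "v \<notin> X"
      and le: "frontier_size n (insert v X) \<le> frontier_size n X"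
      using frontier_size_insert_adjacent[of X n] X \<open>B \<noteq> {}\<close> by blast
    then have "rounds_left (path_graph n) Burner (insert v X) \<le> r"
      using that by (auto simp: rounds_left_Staller_le_Suc_iff X_def)
    then have "2 * card ({..<n} - insert v X) \<le> 2 * r * frontier_size n (insert v X) + r\<^sup>2 + 2 * r"
      using Suc.IH[of "insert v X"] v X by auto
    also have "\<dots> \<le> 2 * r * frontier_size n B + r\<^sup>2 + 2 * r"
      using le frontier by (intro add_mono mult_left_mono) auto
    finally show ?thesis
      using unburned card_unburned_insert[OF v] by (simp add: power2_eq_square algebra_simps)
  qed (rule covered)
  from Burner Staller show ?case by (simp add: add.assoc)
qed

section \<open>Lower bounds for both starting players\<close>

lemma b_g_path_lower: "2 * n + 1 \<le> (b_g (path_graph n) + 1)\<^sup>2"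
  using rounds_left_lower[of "{}" n "b_g (path_graph n)"]
  by (simp add: b_g_def frontier_size_def right_ends_def left_ends_def power2_eq_square)

text \<open>Nothing is burned yet, so round 1 is treated separately: Staller burns the end vertex 0,
  which yields at most one frontier pair instead of two.\<close>

lemma b_g'_path_lower:
  assumes "n \<ge> 1"
  shows "2 * n + 2 \<le> (b_g' (path_graph n) + 1)\<^sup>2"
proof -
  let ?k = "b_g' (path_graph n)"
  have "\<not> rounds_left (path_graph n) Staller {} \<le> 0"
    using assms by (subst rounds_left_le_0_iff) (auto simp: lessThan_empty_iff)
  then obtain r where r: "?k = Suc r"
    unfolding b_g'_def using not0_implies_Suc by auto
  have [simp]: "spread (path_graph n) {} = {}"
    by (simp add: spread_def)
  have "\<forall>v<n. rounds_left (path_graph n) Burner {v} \<le> r"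
    using r rounds_left_Staller_le_Suc_iff[of "path_graph n" "{}" r] by (simp add: b_g'_def)
  then have "rounds_left (path_graph n) Burner {0} \<le> r"
    using assms by auto
  then have "2 * card ({..<n} - {0}) \<le> 2 * r * frontier_size n {0} + r\<^sup>2 + 2 * r"
    using rounds_left_lower[of "{0}" n r] assms by auto
  also have "frontier_size n {0} \<le> 1"
  proof -
    have "right_ends n {0} \<subseteq> {0}" "left_ends n {0} = {}"
      by (auto simp: right_ends_def left_ends_def)
    then show ?thesis
      using card_mono[of "{0::nat}" "right_ends n {0}"] by (simp add: frontier_size_def)
  qed
  finally have "2 * card ({..<n} - {0}) \<le> 2 * r * 1 + r\<^sup>2 + 2 * r"
    by simp
  moreover have "card ({..<n} - {0}) = n - 1"
    using assms by (subst card_Diff_singleton) auto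
  ultimately show ?thesis
    using assms unfolding r by (simp add: power2_eq_square)
qed

section \<open>Burner's strategy\<close>

definition run_starts :: "nat set \<Rightarrow> nat set" where
  "run_starts U = {i \<in> U. i = 0 \<or> i - 1 \<notin> U}"

text \<open>For a single run this reads \<open>card U \<le> r * (r + 1) / 2\<close>, where the right
  side is \<open>(2 * r - 1) + (2 * r - 5) + ...\<close>, the lengths of the intervals around
  Burner's selections in every other round. Every further run costs \<open>r\<close>.\<close>

definition burnable :: "nat \<Rightarrow> nat set \<Rightarrow> bool" where
  "burnable r U \<longleftrightarrow> finite U \<and> 2 * card U + 2 * r * card (run_starts U) \<le> r * (r + 3)"

lemma finite_run_starts [simp]: "finite U \<Longrightarrow> finite (run_starts U)"
  by (simp add: run_starts_def)

lemma run_start_below: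
  assumes "i \<in> U"
  obtains x where "x \<in> run_starts U" "x \<le> i" "{x..i} \<subseteq> U"
proof -
  define x where "x = (LEAST x. {x..i} \<subseteq> U)"
  have x: "{x..i} \<subseteq> U"
    unfolding x_def by (rule LeastI[of _ i]) (use assms in auto)
  have "x \<le> i"
    unfolding x_def by (rule Least_le) (use assms in auto)
  moreover have "x = 0 \<or> x - 1 \<notin> U"
  proof (rule ccontr)
    assume contr: "\<not> ?thesis"
    then have "{x..i} \<union> {x - 1} = {x - 1..i}"
      using \<open>x \<le> i\<close> by auto
    with x contr have "{x - 1..i} \<subseteq> U" by blast
    then have "x \<le> x - 1"
      unfolding x_def by (rule Least_le)
    moreover have "x \<noteq> 0"
      using contr by simp
    ultimately show False by simp
  qed
  ultimately show thesis
    using x by (intro that[of x]) (auto simp: run_starts_def)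
qed

lemma run_starts_nonempty: "U \<noteq> {} \<Longrightarrow> run_starts U \<noteq> {}"
  by (metis all_not_in_conv run_start_below)

text \<open>The assumption says that no run is longer than \<open>a\<close>, so intervals of length
  \<open>a\<close> at the run starts cover \<open>U\<close>.\<close>

lemma card_le_longest_run:
  assumes "finite U" and runs: "\<And>x. x \<in> run_starts U \<Longrightarrow> \<exists>j\<le>a. x + j \<notin> U"
  shows "card U \<le> card (run_starts U) * a"
proof -
  have "U \<subseteq> (\<Union>x\<in>run_starts U. {x..<x + a})"
  proof
    fix i assume "i \<in> U"
    then obtain x where x: "x \<in> run_starts U" "x \<le> i" "{x..i} \<subseteq> U"
      by (rule run_start_below)
    obtain j where "j \<le> a" "x + j \<notin> U"
      using runs[OF x(1)] by blast
    then have "\<not> x + j \<le> i" using x(3) by (metis atLeastAtMost_iff le_add1 subsetD)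
    then show "i \<in> (\<Union>x\<in>run_starts U. {x..<x + a})"
      using x(1,2) \<open>j \<le> a\<close> by (intro UN_I[of x]) auto
  qed
  then have "card U \<le> card (\<Union>x\<in>run_starts U. {x..<x + a})"
    using assms by (intro card_mono) auto
  also have "\<dots> \<le> (\<Sum>x\<in>run_starts U. card {x..<x + a})"
    using assms by (intro card_UN_le) auto
  finally show ?thesis by simp
qed

text \<open>A new run can start only directly behind the removed segment, where it takes the place
  of \<open>x\<close>.\<close>

lemma run_starts_Diff_prefix:
  assumes "x \<in> run_starts U" "0 < c"
  shows "run_starts (U - {x..<x + c}) \<subseteq> insert (x + c) (run_starts U - {x})"
proof
  fix i assume i: "i \<in> run_starts (U - {x..<x + c})"
  show "i \<in> insert (x + c) (run_starts U - {x})"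
  proof (cases "i = 0 \<or> i - 1 \<notin> U")
    case True
    with i assms show ?thesis by (auto simp: run_starts_def)
  next
    case False
    with i have "x \<le> i - 1" "i - 1 < x + c" "\<not> (x \<le> i \<and> i < x + c)" "0 < i"
      by (auto simp: run_starts_def)
    then have "i = x + c" by linarith
    then show ?thesis by simp
  qed
qed

text \<open>Burner removes a longest run, of length \<open>a\<close>, from \<open>m + 1\<close> runs
  with \<open>s\<close> elements in total, while the budget index falls from \<open>r + 2\<close> to
  \<open>r\<close>. If \<open>r + 3 \<le> a + 2 * m\<close>, the first assumption suffices;
  otherwise all runs are short and \<open>s - a \<le> m * a\<close> does.\<close>

lemma longest_run_arith:
  fixes s a m r :: nat
  assumes "2 * s + 2 * (r + 2) * (m + 1) \<le> (r + 2) * (r + 5)" "s \<le> (m + 1) * a" "0 < a" "a \<le> s"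
  shows "2 * (s - a) + 2 * r * m \<le> r * (r + 3)"
proof (cases "r + 3 \<le> a + 2 * m")
  case True
  with assms(1,4) show ?thesis by (simp add: algebra_simps)
next
  case False
  then have le: "2 * m \<le> r + 1" "a \<le> r + 2 - 2 * m"
    using assms(3) by auto
  have "s - a \<le> m * a"
    using assms(2) by simp
  also have "\<dots> \<le> m * (r + 2 - 2 * m)"
    using le(2) by (rule mult_left_mono) simp
  finally have "int (s - a) \<le> int (m * (r + 2 - 2 * m))"
    by (simp only: of_nat_le_iff)
  also have "\<dots> = int m * (int r + 2 - 2 * int m)"
    using le(1) by (simp add: of_nat_diff)
  finally have *: "int (s - a) \<le> int m * (int r + 2 - 2 * int m)" .
  have "m = 0 \<or> 1 \<le> r"
    using le(1) by linarith
  then have "2 * (int m * (int r + 2 - 2 * int m)) + 2 * int r * int m \<le> int r * (int r + 3)"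
  proof
    assume "1 \<le> r"
    \<comment> \<open>This is the difference of the two sides of the goal, with the square
      completed.\<close>
    then have "0 \<le> (int r - 2 * int m + 1)\<^sup>2 + (int r - 1)" by simp
    then show ?thesis by (simp add: power2_eq_square algebra_simps)
  qed simp
  with * have "int (2 * (s - a) + 2 * r * m) \<le> int (r * (r + 3))"
    by simp
  then show ?thesis by (simp only: of_nat_le_iff)
qed

text \<open>With \<open>Suc r\<close> rounds to go, a vertex selected now reaches distance
  \<open>r\<close>, and \<open>r - 1\<close> is the index for Burner's next turn. The result is a
  superset \<open>U'\<close> of the remainder, since passing to a subset can add runs and break the
  budget.\<close>

lemma burnable_Burner_move:
  assumes "burnable (Suc r) U"
  obtains v U' where "U - {v - r..v + r} \<subseteq> U'" "burnable (r - 1) U'"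
proof (cases "U = {}")
  case True
  then show thesis
    using that[of 0 "{}"] by (simp add: burnable_def run_starts_def)
next
  case False
  have fin: "finite U" and
    bound: "2 * card U + 2 * Suc r * card (run_starts U) \<le> Suc r * (Suc r + 3)"
    using assms by (auto simp: burnable_def)
  have m: "0 < card (run_starts U)"
    using run_starts_nonempty[OF False] fin by (simp add: card_gt_0_iff)
  show thesis
  proof (cases "\<exists>x\<in>run_starts U. {x..<x + (2 * r + 1)} \<subseteq> U")
    case True
    then obtain x where x: "x \<in> run_starts U" "{x..<x + (2 * r + 1)} \<subseteq> U"
      by blast
    define U' where "U' = U - {x..<x + (2 * r + 1)}"
    have "card U' = card U - (2 * r + 1)" "2 * r + 1 \<le> card U"
      using x(2) card_mono[OF fin x(2)] by (simp_all add: U'_def card_Diff_subset)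
    then have s: "card U = card U' + 2 * r + 1" by simp
    have m': "card (run_starts U') \<le> card (run_starts U)"
      unfolding U'_def using fin x(1)
      by (intro card_le_swap[OF _ x(1) run_starts_Diff_prefix]) auto
    have "burnable (r - 1) U'"
    proof (cases r)
      case 0
      then have "card U' = 0"
        using bound s m by simp
      then show ?thesis
        using 0 fin by (simp add: burnable_def U'_def)
    next
      case (Suc q)
      \<comment> \<open>The right side falls by
        \<open>(q + 2) * (q + 5) - q * (q + 3) = 4 * q + 10\<close>. The \<open>2 * q + 3\<close>
        removed vertices account for \<open>4 * q + 6\<close>, the lower price of at least one run
        for 4.\<close>
      have "2 * q * card (run_starts U') \<le> 2 * q * card (run_starts U)"
        using m' by simp
      moreover have "4 \<le> 4 * card (run_starts U)"
        using m by simp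
      moreover have "2 * card U + (2 * q * card (run_starts U) + 4 * card (run_starts U))
          \<le> q * (q + 3) + 4 * q + 10"
        using bound by (simp add: Suc algebra_simps)
      moreover have "card U = card U' + 2 * q + 3"
        using s by (simp add: Suc)
      moreover have "finite U'"
        using fin by (simp add: U'_def)
      ultimately have "finite U'" "2 * card U' + 2 * q * card (run_starts U') \<le> q * (q + 3)"
        by linarith+
      then show ?thesis
        by (simp add: burnable_def Suc)
    qed
    moreover have "U - {x + r - r..x + r + r} \<subseteq> U'"
      by (auto simp: U'_def)
    ultimately show thesis
      by (intro that[of "x + r" U'])
  next
    case no_long: False
    define P where "P a \<longleftrightarrow> (\<forall>x\<in>run_starts U. \<exists>j\<le>a. x + j \<notin> U)" for a
    \<comment> \<open>The length of a longest run; as no run has length \<open>2 * r + 1\<close> or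
      more, it is at most \<open>2 * r\<close>.\<close>
    define a where "a = (LEAST a. P a)"
    have "P (2 * r)"
      unfolding P_def
    proof
      fix x assume "x \<in> run_starts U"
      then obtain y where "y \<in> {x..<x + (2 * r + 1)}" "y \<notin> U"
        using no_long by blast
      then show "\<exists>j\<le>2 * r. x + j \<notin> U"
        by (intro exI[of _ "y - x"]) auto
    qed
    then have a: "P a" "a \<le> 2 * r"
      unfolding a_def by (auto intro: LeastI Least_le)
    obtain x0 where "x0 \<in> run_starts U"
      using run_starts_nonempty[OF False] by blast
    then have a_pos: "0 < a"
      using a(1) by (fastforce simp: P_def run_starts_def intro: gr0I)
    then have "\<not> P (a - 1)"
      unfolding a_def by (intro not_less_Least) simp
    then obtain x where x: "x \<in> run_starts U" and run: "\<And>j. j \<le> a - 1 \<Longrightarrow> x + j \<in> U"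
      by (auto simp: P_def)
    obtain j where "j \<le> a" "x + j \<notin> U"
      using a(1) x by (auto simp: P_def)
    with run have end_run: "x + a \<notin> U"
      by (cases "j = a") auto
    have sub: "{x..<x + a} \<subseteq> U"
    proof
      fix y assume "y \<in> {x..<x + a}"
      then show "y \<in> U" using run[of "y - x"] by auto
    qed
    define U' where "U' = U - {x..<x + a}"
    have s: "card U' = card U - a"
      using sub by (simp add: U'_def card_Diff_subset)
    \<comment> \<open>The whole run is removed, so nothing starts at \<open>x + a\<close> and the
      number of runs drops.\<close>
    have "run_starts U' \<subseteq> run_starts U - {x}"
      using run_starts_Diff_prefix[OF x a_pos] end_run by (auto simp: U'_def run_starts_def)
    then have "card (run_starts U') \<le> card (run_starts U - {x})"
      using fin by (intro card_mono) auto
    also have "\<dots> = card (run_starts U) - 1"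
      using x fin by simp
    finally have m': "card (run_starts U') \<le> card (run_starts U) - 1" .
    obtain k where k: "card (run_starts U) = k + 1"
      using m by (metis Suc_eq_plus1 gr0_implies_Suc)
    obtain q where q: "r = Suc q"
      using a(2) a_pos by (cases r) auto
    have "2 * (card U - a) + 2 * q * k \<le> q * (q + 3)"
    proof (rule longest_run_arith)
      show "2 * card U + 2 * (q + 2) * (k + 1) \<le> (q + 2) * (q + 5)"
        using bound unfolding k q by (simp add: eval_nat_numeral)
      show "a \<le> card U"
        using card_mono[OF fin sub] by simp
      show "card U \<le> (k + 1) * a"
        using card_le_longest_run[OF fin, of a] a(1) by (simp add: P_def k)
    qed (rule a_pos)
    moreover have "2 * q * card (run_starts U') \<le> 2 * q * k"
      using m' k by simp
    ultimately have "2 * card U' + 2 * q * card (run_starts U') \<le> q * (q + 3)"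
      using s by linarith
    then have "burnable (r - 1) U'"
      using fin by (simp add: burnable_def q U'_def)
    \<comment> \<open>As \<open>a \<le> 2 * r\<close>, the interval of radius \<open>r\<close>
      around the middle of the run contains all of it.\<close>
    moreover have "U - {x + a div 2 - r..x + a div 2 + r} \<subseteq> U'"
      using a(2) by (auto simp: U'_def)
    ultimately show thesis
      by (intro that[of "x + a div 2" U'])
  qed
qed

lemma run_starts_Diff_interval:
  "run_starts (U - {v - r..v + r}) \<subseteq>
     insert (v + r + 1) (run_starts U - {v - r..v + r})"
proof
  fix i assume i: "i \<in> run_starts (U - {v - r..v + r})"
  show "i \<in> insert (v + r + 1) (run_starts U - {v - r..v + r})"
  proof (cases "i = 0 \<or> i - 1 \<notin> U")
    case True
    with i show ?thesis by (auto simp: run_starts_def)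
  next
    case False
    with i have "v - r \<le> i - 1" "i - 1 \<le> v + r" "\<not> (v - r \<le> i \<and> i \<le> v + r)" "0 < i"
      by (auto simp: run_starts_def)
    then have "i = v + r + 1" by linarith
    then show ?thesis by simp
  qed
qed

text \<open>The number of runs grows by at most 1, and only if the interval splits a run. Then at
  least \<open>r\<close> elements of \<open>U\<close> are lost, which pays the \<open>2 * r\<close>
  for the new run.\<close>

lemma burnable_Staller_move:
  assumes "burnable r U"
  shows "burnable r (U - {v - r..v + r})"
proof -
  let ?I = "{v - r..v + r}"
  have fin: "finite U" and
    bound: "2 * card U + 2 * r * card (run_starts U) \<le> r * (r + 3)"
    using assms by (auto simp: burnable_def)
  have le: "card (U - ?I) \<le> card U"
    using fin by (intro card_mono) auto
  have "2 * card (U - ?I) + 2 * r * card (run_starts (U - ?I))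
      \<le> 2 * card U + 2 * r * card (run_starts U)"
  proof (cases "run_starts U \<inter> ?I = {} \<and> v + r + 1 \<in> run_starts (U - ?I) - run_starts U")
    case True
    \<comment> \<open>Here the interval lies inside a run, because no run starts in it.\<close>
    have "v + r - j \<in> U" if "j \<le> r" for j
      using that
    proof (induction j)
      case 0
      show ?case using True by (auto simp: run_starts_def)
    next
      case (Suc j)
      then have "v + r - j \<in> U" "v + r - j \<in> ?I" by auto
      then have "v + r - j - 1 \<in> U"
        using True by (auto simp: run_starts_def)
      then show ?case by simp
    qed
    \<comment> \<open>The upper half \<open>{v..v + r}\<close> is enough; unlike the lower half it
      is never cut off at 0.\<close>
    then have "(\<lambda>j. v + r - j) ` {..r} \<subseteq> U \<inter> ?I"
      by auto
    then have "card ((\<lambda>j. v + r - j) ` {..r}) \<le> card (U \<inter> ?I)"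
      using fin by (intro card_mono) auto
    moreover have "inj_on (\<lambda>j. v + r - j) {..r}"
      by (auto simp: inj_on_def)
    ultimately have "r \<le> card (U \<inter> ?I)"
      by (simp add: card_image)
    moreover have "card U = card (U \<inter> ?I) + card (U - ?I)"
      using fin by (metis card_Int_Diff)
    ultimately have "card (U - ?I) + r \<le> card U" by simp
    moreover have "card (run_starts (U - ?I)) \<le> card (insert (v + r + 1) (run_starts U))"
      using run_starts_Diff_interval[of U v r] fin by (intro card_mono) auto
    then have "card (run_starts (U - ?I)) \<le> card (run_starts U) + 1"
      using fin by (auto simp: card_insert_if split: if_splits)
    then have "2 * r * card (run_starts (U - ?I)) \<le> 2 * r * (card (run_starts U) + 1)"
      by (rule mult_left_mono) simp
    ultimately show ?thesis by (simp add: algebra_simps)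
  next
    \<comment> \<open>Without a run start in the interval no start is new; otherwise a lost start
      makes up for the possible new one.\<close>
    case False
    have "card (run_starts (U - ?I)) \<le> card (run_starts U)"
    proof (cases "run_starts U \<inter> ?I = {}")
      case True
      with False run_starts_Diff_interval[of U v r] show ?thesis
        using fin by (intro card_mono) auto
    next
      case False
      then obtain i where "i \<in> run_starts U" "i \<in> ?I" by blast
      then show ?thesis
        using run_starts_Diff_interval[of U v r] fin by (intro card_le_swap[of _ i _ "v + r + 1"]) auto
    qed
    then show ?thesis
      using le by (intro add_mono mult_left_mono) auto
  qed
  with bound fin show ?thesis by (simp add: burnable_def)
qed

text \<open>On the path, these are the vertices burned after \<open>r\<close> further spreading
  phases alone; numbers from \<open>n\<close> on may occur too.\<close>

definition covered :: "nat \<Rightarrow> nat set \<Rightarrow> nat set" where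
  "covered r B = (\<Union>u\<in>B. {u - r..u + r})"

text \<open>A spreading phase uses up one unit of distance: a vertex at distance exactly
  \<open>Suc r\<close> from \<open>u\<close> is at distance \<open>r\<close> from the neighbour of
  \<open>u\<close> on its side.\<close>

lemma covered_Suc_subset:
  assumes "B \<subseteq> {..<n}"
  shows "covered (Suc r) B \<inter> {..<n} \<subseteq> covered r (spread (path_graph n) B)"
proof
  fix w assume "w \<in> covered (Suc r) B \<inter> {..<n}"
  then obtain u where u: "u \<in> B" "u - Suc r \<le> w" "w \<le> u + Suc r" "w < n"
    by (auto simp: covered_def)
  then have "u < n" using assms by auto
  consider "u - r \<le> w \<and> w \<le> u + r" | "w = u + Suc r" | "Suc r \<le> u" "w = u - Suc r"
    using u by linarith
  then show "w \<in> covered r (spread (path_graph n) B)"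
  proof cases
    case 1
    then show ?thesis
      using u by (auto simp: covered_def spread_path_graph)
  next
    case 2
    then have "Suc u < n" "w \<in> {Suc u - r..Suc u + r}"
      using u by auto
    moreover from this have "Suc u \<in> spread (path_graph n) B"
      using u(1) \<open>u < n\<close> unfolding spread_path_graph by blast
    ultimately show ?thesis unfolding covered_def by blast
  next
    case 3
    then have "u = Suc (u - 1)" "u - 1 < n" "w \<in> {u - 1 - r..u - 1 + r}"
      using u \<open>u < n\<close> by auto
    moreover from this have "u - 1 \<in> spread (path_graph n) B"
      using u(1) \<open>u < n\<close> unfolding spread_path_graph by blast
    ultimately show ?thesis unfolding covered_def by blast
  qed
qed

lemma covered_insert: "covered r (insert v X) = {v - r..v + r} \<union> covered r X"
  by (auto simp: covered_def)

text \<open>On Staller's turn the index is one lower: it counts the rounds left at Burner's next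
  turn and equals the radius that Staller's selection still reaches, as
  \<open>burnable_Staller_move\<close> requires.\<close>

lemma rounds_left_upper:
  assumes "B \<subseteq> {..<n}" "{..<n} - covered r B \<subseteq> U"
  shows "(burnable r U \<longrightarrow> rounds_left (path_graph n) Burner B \<le> r) \<and>
         (burnable (r - 1) U \<longrightarrow> rounds_left (path_graph n) Staller B \<le> r)"
  using assms
proof (induction r arbitrary: B U)
  case 0
  have "rounds_left (path_graph n) p B \<le> 0" if "burnable 0 U" for p
  proof -
    from that have "U = {}" by (auto simp: burnable_def)
    moreover have "covered 0 B = B" by (simp add: covered_def)
    ultimately show ?thesis
      using 0 by (subst rounds_left_le_0_iff) auto
  qed
  then show ?case by simp
next
  case (Suc r)
  define X where "X = spread (path_graph n) B"
  have X: "X \<subseteq> {..<n}"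
    using spread_path_graph_subset[OF Suc.prems(1)] by (simp add: X_def)
  have U: "{..<n} - covered r X \<subseteq> U"
    using covered_Suc_subset[OF Suc.prems(1), of r] Suc.prems(2) by (auto simp: X_def)
  have "rounds_left (path_graph n) Burner B \<le> Suc r" if burnable: "burnable (Suc r) U"
  proof (cases "{..<n} \<subseteq> X")
    case True
    then show ?thesis by (simp add: rounds_left_Burner_le_Suc_iff X_def)
  next
    case False
    obtain v U' where v: "U - {v - r..v + r} \<subseteq> U'" and U': "burnable (r - 1) U'"
      using burnable_Burner_move[OF burnable] .
    \<comment> \<open>\<open>v\<close> may lie beyond the end of the path, or be burned already. In the latter case
      any other selection does as well.\<close>
    define w where "w = min v (n - 1)"
    have "{v - r..v + r} \<inter> {..<n} \<subseteq> {w - r..w + r}"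
      by (auto simp: w_def)
    with U v have w: "{..<n} - ({w - r..w + r} \<union> covered r X) \<subseteq> U'"
      by blast
    have "\<exists>u\<in>{..<n} - X. {w - r..w + r} \<subseteq> covered r (insert u X)"
    proof (cases "w \<in> X")
      case True
      then have "{w - r..w + r} \<subseteq> covered r X"
        by (auto simp: covered_def)
      with False show ?thesis
        unfolding covered_insert by blast
    next
      case w_notin: False
      have "w < n"
        using False by (auto simp: w_def)
      with w_notin show ?thesis
        unfolding covered_insert by blast
    qed
    then obtain u where u: "u \<in> {..<n} - X" "{w - r..w + r} \<subseteq> covered r (insert u X)"
      by blast
    have "{..<n} - covered r (insert u X) \<subseteq> U'"
      using w u(2) unfolding covered_insert by blast
    then have "rounds_left (path_graph n) Staller (insert u X) \<le> r"
      using Suc.IH[of "insert u X" U'] u(1) X U' by auto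
    with u(1) show ?thesis
      by (auto simp: rounds_left_Burner_le_Suc_iff X_def)
  qed
  moreover have "rounds_left (path_graph n) Staller B \<le> Suc r" if burnable: "burnable r U"
  proof -
    have "rounds_left (path_graph n) Burner (insert v X) \<le> r" if "v \<in> {..<n} - X" for v
    proof -
      have "{..<n} - covered r (insert v X) \<subseteq> U - {v - r..v + r}"
        using U by (auto simp: covered_insert)
      then show ?thesis
        using Suc.IH[of "insert v X" "U - {v - r..v + r}"] that X burnable_Staller_move[OF burnable]
        by auto
    qed
    then show ?thesis by (simp add: rounds_left_Staller_le_Suc_iff X_def)
  qed
  ultimately show ?case by simp
qed

section \<open>Upper bounds for both starting players\<close>

lemma run_starts_lessThan: "run_starts {..<n} \<subseteq> {0}"
  by (auto simp: run_starts_def)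

lemma b_g_path_upper:
  assumes "2 * n \<le> k * (k + 1)"
  shows "b_g (path_graph n) \<le> k"
proof -
  have "card (run_starts {..<n}) \<le> 1"
    using card_mono[OF _ run_starts_lessThan[of n]] by simp
  then have "2 * k * card (run_starts {..<n}) \<le> 2 * k * 1"
    by (rule mult_left_mono) simp
  then have "burnable k {..<n}"
    using assms by (simp add: burnable_def algebra_simps)
  then show ?thesis
    using rounds_left_upper[of "{}" n k "{..<n}"] by (simp add: b_g_def)
qed

text \<open>The assumption is too weak to apply \<open>burnable_Staller_move\<close> to the whole
  path, so the loss is counted exactly. If both sides remain, the \<open>2 * r + 1\<close> removed
  vertices pay for the second run; if one remains, it is a single run and at least
  \<open>r + 1\<close> vertices are removed.\<close>

lemma burnable_first_Staller_move:
  assumes "2 * n \<le> Suc r * (Suc r + 1)" "v < n"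
  shows "burnable r ({..<n} - {v - r..v + r})"
proof -
  define U where "U = {..<n} - {v - r..v + r}"
  have U: "U = {..<v - r} \<union> {v + r + 1..<n}"
    using assms(2) by (auto simp: U_def)
  have card_U: "card U = (v - r) + (n - (v + r + 1))"
    unfolding U by (subst card_Un_disjoint) auto
  have bound: "2 * n \<le> r * r + 3 * r + 2"
    using assms(1) by (simp add: algebra_simps)
  have starts: "run_starts U \<subseteq> {0, v + r + 1}"
    unfolding U by (auto simp: run_starts_def)
  have "2 * card U + 2 * r * card (run_starts U) \<le> r * (r + 3)"
  proof (cases "r < v \<and> v + r + 1 < n")
    case True
    have "card (run_starts U) \<le> 2"
      using card_mono[OF _ starts] by simp
    then have "2 * r * card (run_starts U) \<le> 2 * r * 2"
      by (rule mult_left_mono) simp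
    moreover have "2 * card U + 4 * r + 2 = 2 * n"
      using True card_U by linarith
    moreover have "r * (r + 3) = r * r + 3 * r"
      by (simp add: algebra_simps)
    ultimately show ?thesis
      using bound by linarith
  next
    case False
    then consider "v \<le> r" "n \<le> v + r + 1" | "v \<le> r" "v + r + 1 < n" | "r < v" "n \<le> v + r + 1"
      by linarith
    then show ?thesis
    proof cases
      case 1
      then have "U = {}" by (auto simp: U)
      then show ?thesis by (simp add: run_starts_def)
    next
      case 2
      then have "run_starts U \<subseteq> {v + r + 1}"
        by (auto simp: U run_starts_def)
      then have "card (run_starts U) \<le> 1"
        using card_mono[of "{v + r + 1}"] by simp
      then have "2 * r * card (run_starts U) \<le> 2 * r * 1"
        by (rule mult_left_mono) simp
      then show ?thesis
        using 2 card_U bound by (simp add: algebra_simps)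
    next
      case 3
      then have "run_starts U \<subseteq> {0}"
        by (auto simp: U run_starts_def)
      then have "card (run_starts U) \<le> 1"
        using card_mono[of "{0::nat}"] by simp
      then have "2 * r * card (run_starts U) \<le> 2 * r * 1"
        by (rule mult_left_mono) simp
      then show ?thesis
        using 3 card_U bound assms(2) by (simp add: algebra_simps)
    qed
  qed
  then show ?thesis
    by (simp add: burnable_def U_def)
qed

lemma b_g'_path_upper:
  assumes "2 * n \<le> k * (k + 1)"
  shows "b_g' (path_graph n) \<le> k"
proof (cases k)
  case 0
  with assms show ?thesis
    by (simp add: b_g'_def rounds_left.simps)
next
  case (Suc r)
  have "rounds_left (path_graph n) Burner {v} \<le> r" if "v < n" for v
  proof -
    have "burnable r ({..<n} - {v - r..v + r})"
      using assms that unfolding Suc by (rule burnable_first_Staller_move)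
    moreover have "covered r {v} = {v - r..v + r}"
      by (simp add: covered_def)
    ultimately show ?thesis
      using rounds_left_upper[of "{v}" n r] that by auto
  qed
  moreover have "spread (path_graph n) {} = {}"
    by (simp add: spread_def)
  ultimately have "rounds_left (path_graph n) Staller {} \<le> Suc r"
    by (subst rounds_left_Staller_le_Suc_iff) auto
  then show ?thesis
    by (simp add: b_g'_def Suc)
qed

section \<open>The bounds\<close>

lemma ceiling_sqrt_minus_one_le:
  assumes "m \<le> (k + 1)\<^sup>2"
  shows "\<lceil>sqrt (real m) - 1\<rceil> \<le> int k"
proof -
  have "real m \<le> (real k + 1)\<^sup>2"
    using assms by (metis of_nat_1 of_nat_add of_nat_le_iff of_nat_power)
  then have "sqrt (real m) \<le> real k + 1"
    by (intro real_le_lsqrt) auto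
  then show ?thesis
    by (intro ceiling_le) simp
qed

text \<open>The left side of the assumption is the nonnegative root of
  \<open>x * (x + 1) = 2 * n\<close>.\<close>

lemma triangular_root_le:
  assumes "sqrt (2 * real n + 1 / 4) - 1 / 2 \<le> real k"
  shows "2 * n \<le> k * (k + 1)"
proof -
  have "sqrt (2 * real n + 1 / 4) \<le> real k + 1 / 2"
    using assms by simp
  then have "2 * real n + 1 / 4 \<le> (real k + 1 / 2)\<^sup>2"
    by (rule sqrt_le_D)
  then have "real (2 * n) \<le> real (k * (k + 1))"
    by (simp add: power2_eq_square algebra_simps)
  then show ?thesis
    by (simp only: of_nat_le_iff)
qed

theorem theorem4p3:
  fixes n :: nat
  assumes "n \<ge> 1"
  shows "\<lceil>sqrt (2 * real n + 1) - 1\<rceil> \<le> int (b_g (path_graph n))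
       \<and> int (b_g (path_graph n)) \<le> \<lceil>sqrt (2 * real n + 1 / 4) - 1 / 2\<rceil>
       \<and> \<lceil>sqrt (2 * real n + 2) - 1\<rceil> \<le> int (b_g' (path_graph n))
       \<and> int (b_g' (path_graph n)) \<le> \<lceil>sqrt (2 * real n + 1 / 4) - 1 / 2\<rceil>"
proof -
  define y where "y = sqrt (2 * real n + 1 / 4) - 1 / 2"
  define k where "k = nat \<lceil>y\<rceil>"
  \<comment> \<open>Nonnegativity of \<open>y\<close> ensures that \<open>nat\<close> leaves the
    ceiling unchanged.\<close>
  have "sqrt (1 / 4) \<le> sqrt (2 * real n + 1 / 4)"
    by (intro real_sqrt_le_mono) simp
  then have "0 \<le> y"
    by (simp add: y_def real_sqrt_divide)
  then have k: "int k = \<lceil>y\<rceil>"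
    by (simp add: k_def)
  have "y \<le> real_of_int (int k)"
    unfolding k by (rule le_of_int_ceiling)
  then have "2 * n \<le> k * (k + 1)"
    by (intro triangular_root_le) (simp add: y_def)
  then have "int (b_g (path_graph n)) \<le> \<lceil>y\<rceil>" "int (b_g' (path_graph n)) \<le> \<lceil>y\<rceil>"
    using b_g_path_upper b_g'_path_upper by (simp_all flip: k)
  moreover have "\<lceil>sqrt (2 * real n + 1) - 1\<rceil> \<le> int (b_g (path_graph n))"
    using ceiling_sqrt_minus_one_le[OF b_g_path_lower[of n]] by (simp add: add.commute)
  moreover have "\<lceil>sqrt (2 * real n + 2) - 1\<rceil> \<le> int (b_g' (path_graph n))"
    using ceiling_sqrt_minus_one_le[OF b_g'_path_lower[OF assms]] by (simp add: add.commute)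
  ultimately show ?thesis
    by (simp add: y_def)
qed

end
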